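(* Let $0\le c<1/2$ and let $(p_n)_{n\ge1}$ be a sequence in $[0,1]$ with $p_n=\Omega(n^{-c})$, and for each $n$ let $G_n$ be a random directed acyclic graph drawn from $D(n,p_n)$. Then for all $\epsilon>0$ and $\delta>0$ there exists $N$ such that for all $n\ge N$, $$P[\mathrm{GAPEB}(G_n)<1+\delta]>1-\epsilon.$$
   Context: $p_n=\Omega(n^{-c})$ means there exist $k>0$ and $n_0$ with $p_n \ge k n^{-c}$ for all $n\ge n_0$. The distribution $D(n,p)$ on directed acyclic graphs with vertex set $\{1,\dots,n\}$ is obtained by including each of the $\binom{n}{2}$ pairs $\{i,j\}$ independently with probability $p$ and orienting each included edge from $i$ to $j$ when $i<j$. For a directed acyclic graph $G=(V,E)$ with $|V|=n$, a layout is a bijection $\phi:V\to\{1,\dots,n\}$ such that $\phi(u)<\phi(v)$ for every directed edge $(u,v)\in E$ (a topological ordering). For $1\le i\le n$, $\theta(i,\phi,G)$ is the number of edges $(u,v)\in E$ with $\phi(u)\le i<\phi(v)$. Define $\mathrm{EB}(G,\phi)=\theta(\lfloor n/2\rfloor,\phi,G)$, $\mathrm{MINEB}(G)=\min_\phi\mathrm{EB}(G,\phi)$, $\mathrm{MAXEB}(G)=\max_\phi\mathrm{EB}(G,\phi)$ over all layouts $\phi$ of $G$, and $\mathrm{GAPEB}(G)=\mathrm{MAXEB}(G)/\mathrm{MINEB}(G)$. *)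

theory Defs
  imports "HOL-Probability.Probability"
begin

type_synonym 'v digraph = "'v set \<times> ('v \<times> 'v) set"

definition layouts :: "'v digraph \<Rightarrow> ('v \<Rightarrow> nat) set" where
  "layouts G = {\<phi>. bij_betw \<phi> (fst G) {1..card (fst G)} \<and> (\<forall>(u, v) \<in> snd G. \<phi> u < \<phi> v)}"

definition theta :: "nat \<Rightarrow> ('v \<Rightarrow> nat) \<Rightarrow> 'v digraph \<Rightarrow> nat" where
  "theta i \<phi> G = card {(u, v) \<in> snd G. \<phi> u \<le> i \<and> i < \<phi> v}"

definition EB :: "'v digraph \<Rightarrow> ('v \<Rightarrow> nat) \<Rightarrow> nat" where
  "EB G \<phi> = theta (card (fst G) div 2) \<phi> G"

text \<open>
  Layouts are unconstrained outside the vertex set, so there may be infinitely many of them as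
  HOL functions. The set of values of \<^const>\<open>EB\<close> is nevertheless finite (bounded by the number
  of edges), and it is nonempty for every finite acyclic graph, so \<^const>\<open>Min\<close> and \<^const>\<open>Max\<close>
  are meaningful.
\<close>

definition MINEB :: "'v digraph \<Rightarrow> nat" where
  "MINEB G = Min (EB G ` layouts G)"

definition MAXEB :: "'v digraph \<Rightarrow> nat" where
  "MAXEB G = Max (EB G ` layouts G)"

text \<open>
  If the denominator vanishes the gap is \<open>\<infinity>\<close>; the HOL convention \<open>x / 0 = 0\<close> on the reals
  would wrongly make such graphs satisfy every upper bound on the gap.
\<close>

definition GAPEB :: "'v digraph \<Rightarrow> ereal" where
  "GAPEB G = (if MINEB G = 0 then \<infinity> else ereal (real (MAXEB G) / real (MINEB G)))"

definition ordered_pairs :: "nat \<Rightarrow> (nat \<times> nat) set" where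
  "ordered_pairs n = {(i, j). 1 \<le> i \<and> i < j \<and> j \<le> n}"

text \<open>The distribution $D(n,p)$: one independent coin flip per pair $i < j$, the edge going from
  $i$ to $j$. Meaningful for \<open>0 \<le> p \<le> 1\<close>.\<close>

definition random_dag :: "nat \<Rightarrow> real \<Rightarrow> nat digraph pmf" where
  "random_dag n p =
     map_pmf (\<lambda>f. ({1..n}, {e \<in> ordered_pairs n. f e}))
       (Pi_pmf (ordered_pairs n) False (\<lambda>_. bernoulli_pmf p))"

end

theory Submission
  imports Defs "HOL-Real_Asymp.Real_Asymp"
begin

text \<open>
  Hoeffding's inequality and a union bound over the at most \<open>4 ^ n\<close> pairs \<open>(U, W)\<close> of vertex
  sets show that, with high probability, the number of edges from \<open>U\<close> to \<open>W\<close> deviates from its mean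
  by less than \<open>s\<^sup>2 * p * n\<^sup>2\<close> for all \<open>U\<close> and \<open>W\<close> at once; this is where
  \<open>p\<^sup>2 * n \<longrightarrow> \<infinity>\<close>, i.e. \<open>c < 1/2\<close>, enters.
  Now let \<open>S\<close> be the first half of a layout, \<open>L = {1..n div 2}\<close>, and \<open>m = card (L - S) = card (S - L)\<close>.
  All \<open>m\<^sup>2\<close> pairs in \<open>(L - S) \<times> (S - L)\<close> are potential edges, but none of them is present since the
  layout would reverse it. Hence \<open>m < s * n\<close>, so there are \<open>n\<^sup>2 / 4\<close> potential edges from \<open>S\<close> to its
  complement up to an error of \<open>s * n\<^sup>2\<close>, and every layout has bisection about \<open>p * n\<^sup>2 / 4\<close>.
\<close>

section \<open>Concentration of the edge counts between vertex sets\<close>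

definition edge_regular :: "nat \<Rightarrow> real \<Rightarrow> real \<Rightarrow> (nat \<times> nat) set \<Rightarrow> bool" where
  "edge_regular n p t E \<longleftrightarrow> (\<forall>U\<subseteq>{1..n}. \<forall>W\<subseteq>{1..n}.
     \<bar>real (card (E \<inter> U \<times> W)) - real (card (ordered_pairs n \<inter> U \<times> W)) * p\<bar> < t)"

lemma ordered_pairs_subset: "ordered_pairs n \<subseteq> {1..n} \<times> {1..n}"
  by (auto simp: ordered_pairs_def)

lemma finite_ordered_pairs [simp]: "finite (ordered_pairs n)"
  by (rule finite_subset[OF ordered_pairs_subset]) simp

text \<open>The count is binomial with \<open>card Q\<close> trials, so two-sided Hoeffding applies.
  Weakening \<open>card Q\<close> to a bound \<open>N\<close> gives an estimate uniform in
  \<open>Q\<close>, as the union bound wants.\<close>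

lemma prob_count_deviation:
  assumes "finite A" "Q \<subseteq> A" "0 \<le> p" "p \<le> 1" "0 < t" "card Q \<le> N"
  shows "measure_pmf.prob (Pi_pmf A False (\<lambda>_. bernoulli_pmf p))
           {f. t \<le> \<bar>real (card {e\<in>Q. f e}) - real (card Q) * p\<bar>} \<le> 2 * exp (- 2 * t\<^sup>2 / real N)"
proof (cases "Q = {}")
  case True
  \<comment> \<open>Hoeffding's bound is stated for a positive number of trials. For empty
    \<open>Q\<close> the deviation is 0, so the event is empty.\<close>
  then show ?thesis using assms by (simp add: not_le)
next
  case False
  have fQ: "finite Q" using assms finite_subset by blast
  with False have Q: "card Q > 0" by (simp add: card_gt_0_iff)
  interpret binomial_distribution "card Q" p
    by unfold_locales (use assms in auto)
  have "binomial_pmf (card Q) p = map_pmf (\<lambda>f. card {e\<in>Q. f e}) (Pi_pmf Q False (\<lambda>_. bernoulli_pmf p))"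
    by (rule binomial_pmf_altdef') (use fQ assms in auto)
  \<comment> \<open>Resetting the coins outside \<open>Q\<close> to the default \<open>False\<close>
    does not change the count, which only reads coins in \<open>Q\<close>.\<close>
  also have "Pi_pmf Q False (\<lambda>_. bernoulli_pmf p) =
      map_pmf (\<lambda>f x. if x \<in> Q then f x else False) (Pi_pmf A False (\<lambda>_. bernoulli_pmf p))"
    by (rule Pi_pmf_subset) (use assms in auto)
  finally have eq: "binomial_pmf (card Q) p =
      map_pmf (\<lambda>f. card {e\<in>Q. f e}) (Pi_pmf A False (\<lambda>_. bernoulli_pmf p))"
    by (simp add: pmf.map_comp o_def cong: conj_cong)
  have "measure_pmf.prob (Pi_pmf A False (\<lambda>_. bernoulli_pmf p))
      {f. t \<le> \<bar>real (card {e\<in>Q. f e}) - real (card Q) * p\<bar>}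
      = measure_pmf.prob (binomial_pmf (card Q) p) {x. t \<le> \<bar>real x - real (card Q) * p\<bar>}"
    by (simp add: eq)
  also have "\<dots> \<le> 2 * exp (- 2 * t\<^sup>2 / real (card Q))"
    using prob_abs_ge[OF Q, of t] assms by simp
  also have "\<dots> \<le> 2 * exp (- 2 * t\<^sup>2 / real N)"
    using Q assms by (simp add: frac_le)
  finally show ?thesis .
qed

text \<open>Union bound over \<open>4 ^ n\<close> pairs of sets, with the crude
  \<open>N = n\<^sup>2\<close> for every pair. The first two conditions on \<open>G\<close> hold
  surely; they are recorded so that the deterministic estimates apply to each graph in the
  event.\<close>

lemma prob_edge_regular:
  assumes "0 \<le> p" "p \<le> 1" "0 < t"
  shows "measure_pmf.prob (random_dag n p)
           {G. fst G = {1..n} \<and> snd G \<subseteq> ordered_pairs n \<and> edge_regular n p t (snd G)}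
         \<ge> 1 - 4 ^ n * (2 * exp (- 2 * t\<^sup>2 / real (n\<^sup>2)))" (is "_ \<le> ?P")
proof -
  define M where "M = Pi_pmf (ordered_pairs n) False (\<lambda>_. bernoulli_pmf p)"
  define Q where "Q = (\<lambda>(U, W). ordered_pairs n \<inter> U \<times> W)"
  define bad where
    "bad = (\<lambda>UW. {f. t \<le> \<bar>real (card {e\<in>Q UW. f e}) - real (card (Q UW)) * p\<bar>})"
  define I where "I = Pow {1..n} \<times> Pow {1..n}"
  have I: "finite I" "card I = 4 ^ n"
    by (simp_all add: I_def card_cartesian_product card_Pow power_mult_distrib[symmetric])
  have "measure_pmf.prob M (\<Union>i\<in>I. bad i) \<le> (\<Sum>i\<in>I. measure_pmf.prob M (bad i))"
    by (intro measure_pmf.finite_measure_subadditive_finite) (auto simp: I)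
  also have "\<dots> \<le> (\<Sum>i\<in>I. 2 * exp (- 2 * t\<^sup>2 / real (n\<^sup>2)))"
  proof (rule sum_mono)
    fix i assume "i \<in> I"
    have "Q i \<subseteq> {1..n} \<times> {1..n}"
      using ordered_pairs_subset by (auto simp: Q_def split: prod.splits)
    then have "card (Q i) \<le> card ({1..n} \<times> {1..n})"
      by (intro card_mono) auto
    then have "card (Q i) \<le> n\<^sup>2"
      by (simp add: power2_eq_square)
    then show "measure_pmf.prob M (bad i) \<le> 2 * exp (- 2 * t\<^sup>2 / real (n\<^sup>2))"
      unfolding bad_def M_def
      by (intro prob_count_deviation) (use assms in \<open>auto simp: Q_def split: prod.splits\<close>)
  qed
  also have "\<dots> = 4 ^ n * (2 * exp (- 2 * t\<^sup>2 / real (n\<^sup>2)))"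
    by (simp add: I)
  finally have *: "measure_pmf.prob M (\<Union>i\<in>I. bad i) \<le> 4 ^ n * (2 * exp (- 2 * t\<^sup>2 / real (n\<^sup>2)))" .
  have "- (\<Union>i\<in>I. bad i) \<subseteq> {f. edge_regular n p t {e \<in> ordered_pairs n. f e}}"
  proof safe
    fix f assume f: "f \<notin> (\<Union>i\<in>I. bad i)"
    have "\<bar>real (card ({e \<in> ordered_pairs n. f e} \<inter> U \<times> W))
        - real (card (ordered_pairs n \<inter> U \<times> W)) * p\<bar> < t"
      if "U \<subseteq> {1..n}" "W \<subseteq> {1..n}" for U W
    proof -
      have "f \<notin> bad (U, W)" using f that by (auto simp: I_def)
      moreover have "{e \<in> ordered_pairs n. f e} \<inter> U \<times> W = {e \<in> Q (U, W). f e}"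
        by (auto simp: Q_def)
      ultimately show ?thesis by (simp add: bad_def Q_def not_le)
    qed
    then show "edge_regular n p t {e \<in> ordered_pairs n. f e}"
      by (auto simp: edge_regular_def)
  qed
  then have "measure_pmf.prob M (- (\<Union>i\<in>I. bad i))
      \<le> measure_pmf.prob M {f. edge_regular n p t {e \<in> ordered_pairs n. f e}}"
    by (intro measure_pmf.finite_measure_mono) auto
  also have "\<dots> = ?P"
    unfolding random_dag_def M_def
    by (simp add: vimage_def)
  finally have "measure_pmf.prob M (- (\<Union>i\<in>I. bad i)) \<le> ?P" .
  moreover have "measure_pmf.prob M (- (\<Union>i\<in>I. bad i)) = 1 - measure_pmf.prob M (\<Union>i\<in>I. bad i)"
    using measure_pmf.prob_compl[of "\<Union>i\<in>I. bad i" M] by (simp add: Compl_eq_Diff_UNIV)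
  ultimately show ?thesis using * by linarith
qed

section \<open>Deterministic bounds on the bisection of a layout\<close>

text \<open>The term in \<open>s\<^sup>2\<close> is the regularity error. The term in
  \<open>s\<close> counts potential edges lost to misplaced vertices; it is absent above because
  \<open>S \<times> T\<close> never has more than \<open>h * (n - h)\<close> pairs.\<close>

lemma EB_bounds:
  fixes n :: nat and p s :: real
  defines "h \<equiv> n div 2"
  assumes E: "E \<subseteq> ordered_pairs n" and reg: "edge_regular n p (s\<^sup>2 * p * (real n)\<^sup>2) E"
    and p: "0 < p" and s: "0 \<le> s" and \<phi>: "\<phi> \<in> layouts ({1..n}, E)"
  shows "real (EB ({1..n}, E) \<phi>) \<le> p * (real h * (real n - real h) + s\<^sup>2 * (real n)\<^sup>2)" (is ?upper)
    and "real (EB ({1..n}, E) \<phi>) \<ge>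
           p * (real h * (real n - real h) - s * (real n)\<^sup>2 - s\<^sup>2 * (real n)\<^sup>2)" (is ?lower)
proof -
  define S where "S = {v\<in>{1..n}. \<phi> v \<le> h}"
  define T where "T = {1..n} - S"
  define L where "L = {1..h}"
  define R where "R = {1..n} - L"
  define m where "m = card (L - S)"
  have h: "h \<le> n" by (simp add: h_def)
  have bij: "bij_betw \<phi> {1..n} {1..n}" and mono: "\<And>u v. (u, v) \<in> E \<Longrightarrow> \<phi> u < \<phi> v"
    using \<phi> by (auto simp: layouts_def)
  have [simp]: "finite S" "finite L" "finite R" "finite T" "card L = h"
    by (auto simp: S_def T_def L_def R_def)
  have sub: "S \<subseteq> {1..n}" "L \<subseteq> {1..n}" "R \<subseteq> {1..n}" "T \<subseteq> {1..n}"
    using h by (auto simp: S_def T_def L_def R_def)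
  have "\<phi> ` S = {1..h}"
  proof
    show "\<phi> ` S \<subseteq> {1..h}"
      using bij_betw_imp_surj_on[OF bij] by (auto simp: S_def)
    show "{1..h} \<subseteq> \<phi> ` S"
    proof
      fix i assume i: "i \<in> {1..h}"
      then have "i \<in> \<phi> ` {1..n}"
        using bij_betw_imp_surj_on[OF bij] h by auto
      with i show "i \<in> \<phi> ` S" by (auto simp: S_def)
    qed
  qed
  moreover have "inj_on \<phi> S"
    using bij sub(1) inj_on_subset unfolding bij_betw_def by blast
  ultimately have cS: "card S = h"
    by (metis card_image card_atLeastAtMost diff_Suc_1)
  have cT: "card T = n - h" and cR: "card R = n - h"
    using sub h by (simp_all add: T_def R_def card_Diff_subset cS)
  have m': "card (S - L) = m"
    unfolding m_def using card_le_sym_Diff[of S L] card_le_sym_Diff[of L S] cS by simp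
  \<comment> \<open>This and \<open>mR\<close> make the truncated differences \<open>h - m\<close>
    and \<open>n - h - m\<close> below agree with the real ones.\<close>
  have mh: "m \<le> h" unfolding m_def
    using card_mono[of L "L - S"] by simp
  have "S - L \<subseteq> R" using sub by (auto simp: R_def)
  then have mR: "m \<le> n - h"
    using card_mono[of R "S - L"] cR m' by simp
  have EB: "EB ({1..n}, E) \<phi> = card (E \<inter> S \<times> T)"
    unfolding EB_def theta_def using E ordered_pairs_subset[of n]
    by (intro arg_cong[where f = card]) (auto simp: S_def T_def h_def)
  have reg': "\<bar>real (card (E \<inter> U \<times> W)) - real (card (ordered_pairs n \<inter> U \<times> W)) * p\<bar>
      < s\<^sup>2 * p * (real n)\<^sup>2" if "U \<subseteq> {1..n}" "W \<subseteq> {1..n}" for U W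
    using reg that by (auto simp: edge_regular_def)

  have "E \<inter> (L - S) \<times> (S - L) = {}"
    using mono sub by (force simp: S_def)
  moreover have "ordered_pairs n \<inter> (L - S) \<times> (S - L) = (L - S) \<times> (S - L)"
    using h by (auto simp: ordered_pairs_def L_def S_def)
  \<comment> \<open>With no edge present the deviation is the whole mean
    \<open>m\<^sup>2 * p\<close>. The error is proportional to \<open>p\<close>, so \<open>p\<close>
    cancels, and its factor is a square so that the root is \<open>s * n\<close>.\<close>
  ultimately have "(real m)\<^sup>2 * p < s\<^sup>2 * p * (real n)\<^sup>2"
    using reg'[of "L - S" "S - L"] sub m' p
    by (auto simp: m_def card_cartesian_product power2_eq_square)
  then have "(real m)\<^sup>2 < (s * real n)\<^sup>2"
    using p by (simp add: power_mult_distrib mult.commute mult.left_commute)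
  then have ms: "real m \<le> s * real n"
    by (rule power2_le_imp_le[OF less_imp_le]) (use s in simp)

  define q where "q = card (ordered_pairs n \<inter> S \<times> T)"
  have "q \<le> card (S \<times> T)"
    unfolding q_def by (intro card_mono) auto
  then have q_le: "real q \<le> real h * (real n - real h)"
    using h by (simp add: card_cartesian_product cS cT flip: of_nat_diff of_nat_mult)
  \<comment> \<open>Every vertex of \<open>L\<close> precedes every vertex of \<open>R\<close>, so
    discarding the \<open>m\<close> misplaced vertices on each side leaves a full rectangle of
    potential edges.\<close>
  have "(S \<inter> L) \<times> (R - S) \<subseteq> ordered_pairs n \<inter> S \<times> T"
    using sub by (auto simp: ordered_pairs_def L_def R_def T_def)
  then have "card ((S \<inter> L) \<times> (R - S)) \<le> q"
    unfolding q_def by (intro card_mono) auto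
  moreover have "card (S \<inter> L) = h - m"
    using card_Diff_subset_Int[of L S] mh by (simp add: m_def Int_commute)
      (metis \<open>card L = h\<close> \<open>finite L\<close> card_mono diff_diff_cancel inf.cobounded1)
  moreover have "card (R - S) = n - h - m"
  proof -
    have "R \<inter> S = S - L" using sub by (auto simp: R_def)
    then show ?thesis
      using card_Diff_subset_Int[of R S] cR m' by simp
  qed
  ultimately have "real (h - m) * real (n - h - m) \<le> real q"
    by (simp add: card_cartesian_product flip: of_nat_mult)
  then have "(real h - real m) * (real n - real h - real m) \<le> real q"
    using mh mR h by (simp add: of_nat_diff diff_diff_eq)
  moreover have "(real h - real m) * (real n - real h - real m)
      = real h * (real n - real h) - real m * real n + (real m)\<^sup>2"
    by (simp add: algebra_simps power2_eq_square)
  moreover have "real m * real n \<le> s * (real n)\<^sup>2"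
    using mult_right_mono[OF ms, of "real n"] by (simp add: power2_eq_square mult.assoc)
  ultimately have q_ge: "real h * (real n - real h) - s * (real n)\<^sup>2 \<le> real q"
    using zero_le_power2[of "real m"] by linarith

  have dev: "\<bar>real (EB ({1..n}, E) \<phi>) - real q * p\<bar> < s\<^sup>2 * p * (real n)\<^sup>2"
    using reg'[OF sub(1) sub(4)] by (simp only: EB q_def)
  show ?upper using dev mult_right_mono[OF q_le, of p] p by (simp add: algebra_simps)
  show ?lower using dev mult_right_mono[OF q_ge, of p] p by (simp add: algebra_simps)
qed

lemma finite_EB_layouts: "finite (snd G) \<Longrightarrow> finite (EB G ` layouts G)"
  by (rule finite_subset[of _ "{..card (snd G)}"])
     (auto simp: EB_def theta_def intro!: card_mono)

lemma GAPEB_less: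
  assumes E: "E \<subseteq> ordered_pairs n" and "0 < a" "0 \<le> \<delta>"
    and bounds: "\<And>\<phi>. \<phi> \<in> layouts ({1..n}, E) \<Longrightarrow>
      a \<le> real (EB ({1..n}, E) \<phi>) \<and> real (EB ({1..n}, E) \<phi>) \<le> b"
    and b: "b < (1 + \<delta>) * a"
  shows "GAPEB ({1..n}, E) < ereal (1 + \<delta>)"
proof -
  let ?G = "({1..n}, E)"
  have fin: "finite (EB ?G ` layouts ?G)"
    using finite_subset[OF E] by (intro finite_EB_layouts) simp
  \<comment> \<open>Edges only go upwards, so the identity is a layout and \<open>Min\<close> and
    \<open>Max\<close> are attained.\<close>
  have "id \<in> layouts ?G"
    using E by (auto simp: layouts_def ordered_pairs_def)
  then have ne: "EB ?G ` layouts ?G \<noteq> {}" by blast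
  have "MINEB ?G \<in> EB ?G ` layouts ?G" "MAXEB ?G \<in> EB ?G ` layouts ?G"
    unfolding MINEB_def MAXEB_def using fin ne by (auto intro: Min_in Max_in)
  then have "a \<le> real (MINEB ?G)" "real (MAXEB ?G) \<le> b"
    using bounds by auto
  moreover from this have "real (MAXEB ?G) < (1 + \<delta>) * real (MINEB ?G)"
    using b mult_left_mono[of a "real (MINEB ?G)" "1 + \<delta>"] assms(3) by linarith
  ultimately show ?thesis
    using \<open>0 < a\<close> by (auto simp: GAPEB_def divide_less_eq)
qed

text \<open>With \<open>x = n\<^sup>2\<close> and \<open>s\<^sup>2 \<le> s\<close>, the ratio bound
  follows from \<open>3 * (1 + \<delta>) * s * x < \<delta> * H\<close>. The choice of
  \<open>s\<close> makes the left side \<open>3 * \<delta> * x / 32\<close>, while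
  \<open>H \<ge> x / 8\<close> makes the right side at least
  \<open>4 * \<delta> * x / 32\<close>.\<close>

lemma GAPEB_less_of_edge_regular:
  fixes n :: nat and p \<delta> :: real
  defines "s \<equiv> \<delta> / (32 * (1 + \<delta>))"
  assumes E: "E \<subseteq> ordered_pairs n" and reg: "edge_regular n p (s\<^sup>2 * p * (real n)\<^sup>2) E"
    and p: "0 < p" and \<delta>: "0 < \<delta>" and n: "2 \<le> n"
  shows "GAPEB ({1..n}, E) < ereal (1 + \<delta>)"
proof -
  define h where "h = n div 2"
  define H where "H = real h * (real n - real h)"
  define x where "x = (real n)\<^sup>2"
  have x: "x \<ge> 4" using power_mono[of 2 "real n" 2] n by (simp add: x_def)
  have "real n = 2 * real h \<or> real n = 2 * real h + 1"
    unfolding h_def by (cases "even n") (auto elim!: evenE oddE)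
  then have "4 * H \<ge> x - 1"
    by (auto simp: H_def x_def power2_eq_square algebra_simps)
  with x have H: "H \<ge> x / 8" by simp
  have s: "0 < s" "s \<le> 1 / 32" "(1 + \<delta>) * s = \<delta> / 32"
    using \<delta> by (auto simp: s_def field_simps)
  have "s\<^sup>2 \<le> s" using s by (simp add: power2_eq_square mult_left_le)
  then have s2: "s\<^sup>2 * x \<le> s * x" using x by (intro mult_right_mono) auto
  have "(1 + \<delta>) * s * x = \<delta> / 32 * x" by (simp only: s(3))
  then have sx: "s * x + \<delta> * (s * x) = \<delta> * x / 32" by (simp add: algebra_simps)
  have pos: "0 < s * x" "0 < \<delta> * x" "0 < \<delta> * (s * x)"
    using s(1) x \<delta> by auto
  have "\<delta> * x / 8 \<le> \<delta> * H"
    using mult_left_mono[OF H, of \<delta>] \<delta> by simp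
  then have key: "H + s\<^sup>2 * x < (1 + \<delta>) * (H - 2 * (s * x))"
    using s2 sx pos by (simp add: algebra_simps)
  \<comment> \<open>The left side of \<open>key\<close> is positive, hence so is the lower bound on
    the bisection. This excludes the infinite gap.\<close>
  have "0 < (1 + \<delta>) * (H - 2 * (s * x))"
    using key H x mult_nonneg_nonneg[of "s\<^sup>2" x] zero_le_power2[of s] by linarith
  then have H': "0 < H - 2 * (s * x)"
    using \<delta> by (simp add: zero_less_mult_iff)
  show ?thesis
  proof (rule GAPEB_less[OF E, where a = "p * (H - 2 * (s * x))" and b = "p * (H + s\<^sup>2 * x)"])
    show "p * (H + s\<^sup>2 * x) < (1 + \<delta>) * (p * (H - 2 * (s * x)))"
      using mult_strict_left_mono[OF key p] by (simp add: mult.left_commute)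
  next
    fix \<phi> assume "\<phi> \<in> layouts ({1..n}, E)"
    note B = EB_bounds[OF E reg p less_imp_le[OF s(1)] this, folded h_def, folded H_def x_def]
    have "p * (H - 2 * (s * x)) \<le> p * (H - s * x - s\<^sup>2 * x)"
      using s2 p by (intro mult_left_mono) auto
    with B show "p * (H - 2 * (s * x)) \<le> real (EB ({1..n}, E) \<phi>) \<and>
        real (EB ({1..n}, E) \<phi>) \<le> p * (H + s\<^sup>2 * x)" by simp
  qed (use p H' \<delta> in auto)
qed

section \<open>Asymptotics of the failure probability\<close>

theorem theorem4:
  fixes c :: real and p :: "nat \<Rightarrow> real"
  assumes "0 \<le> c" and "c < 1 / 2"
    and "\<And>n. n \<ge> 1 \<Longrightarrow> 0 \<le> p n \<and> p n \<le> 1"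
    and "\<exists>k>0. \<exists>n0::nat. \<forall>n\<ge>n0. p n \<ge> k * real n powr (- c)"
  shows "\<forall>\<epsilon>>0. \<forall>\<delta>>0. \<exists>N::nat. \<forall>n\<ge>N.
    measure_pmf.prob (random_dag n (p n)) {G. GAPEB G < ereal (1 + \<delta>)} > 1 - \<epsilon>"
proof (intro allI impI)
  fix \<epsilon> \<delta> :: real assume \<epsilon>: "0 < \<epsilon>" and \<delta>: "0 < \<delta>"
  define s where "s = \<delta> / (32 * (1 + \<delta>))"
  have s: "s > 0" using \<delta> by (simp add: s_def)
  obtain k n0 where k: "k > 0" and pk: "\<And>n. n \<ge> n0 \<Longrightarrow> p n \<ge> k * real n powr (- c)"
    using assms(4) by blast
  \<comment> \<open>For \<open>t = s\<^sup>2 * p n * n\<^sup>2\<close>, the quantity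
    \<open>t\<^sup>2 / n\<^sup>2\<close> is at least \<open>K * n powr (1 - 2 * c) * n\<close>.
    Since \<open>c < 1/2\<close>, this eventually exceeds \<open>2 * n\<close>, which makes each
    Hoeffding bound at most \<open>2 * exp (- 4 * n)\<close>.\<close>
  define K where "K = s ^ 4 * k\<^sup>2"
  have K: "K > 0" using s k by (simp add: K_def)
  have "filterlim (\<lambda>n. K * real n powr (1 - 2 * c)) at_top sequentially"
    using K assms(2) by real_asymp
  then have ev1: "eventually (\<lambda>n. K * real n powr (1 - 2 * c) \<ge> 2) sequentially"
    by (simp add: filterlim_at_top)
  have "(\<lambda>n. 2 * exp (- 2 * real n)) \<longlonglongrightarrow> 0"
    by real_asymp
  then have ev2: "eventually (\<lambda>n. 2 * exp (- 2 * real n) < \<epsilon>) sequentially"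
    using \<epsilon> by (rule order_tendstoD)
  have "eventually (\<lambda>n. measure_pmf.prob (random_dag n (p n)) {G. GAPEB G < ereal (1 + \<delta>)} > 1 - \<epsilon>)
      sequentially"
    using ev1 ev2 eventually_ge_at_top[of n0] eventually_ge_at_top[of 2]
  proof eventually_elim
    case (elim n)
    define x where "x = real n"
    have x: "x \<ge> 2" using elim by (simp add: x_def)
    have "0 < k * x powr (- c)"
      using k x by simp
    then have pn: "k * x powr (- c) \<le> p n" "p n \<le> 1" "0 < p n"
      using pk[OF elim(3)] assms(3)[of n] elim(4) unfolding x_def by linarith+
    define t where "t = s\<^sup>2 * p n * x\<^sup>2"
    have t: "t > 0" using s pn x by (simp add: t_def)
    have "2 * x \<le> K * x powr (1 - 2 * c) * x"
      using elim(1) x by (simp add: x_def)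
    also have "\<dots> = s ^ 4 * (k * x powr (- c))\<^sup>2 * x\<^sup>2"
    proof -
      have "x powr (1 - 2 * c) * x = (x powr (- c))\<^sup>2 * x\<^sup>2"
        using x by (simp add: powr_diff powr_minus power2_eq_square field_simps flip: powr_add)
      then show ?thesis by (simp add: K_def power_mult_distrib algebra_simps)
    qed
    also have "\<dots> \<le> s ^ 4 * (p n)\<^sup>2 * x\<^sup>2"
      using pn k by (intro mult_right_mono mult_left_mono power_mono) auto
    also have "\<dots> = t\<^sup>2 / x\<^sup>2"
      using x by (simp add: t_def field_simps flip: power_mult power_add)
    finally have e: "2 * x \<le> t\<^sup>2 / x\<^sup>2" .
    \<comment> \<open>The union bound thus costs at most \<open>exp (2 * n)\<close>, leaving a
      failure probability of at most \<open>2 * exp (- 2 * n)\<close>.\<close>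
    have "(4::real) \<le> exp 2"
    proof -
      have "(2::real) \<le> exp 1" using exp_ge_add_one_self[of 1] by simp
      then have "2 * 2 \<le> exp 1 * exp (1::real)" by (intro mult_mono) auto
      then show ?thesis by (simp flip: exp_add)
    qed
    then have "(4::real) ^ n \<le> exp 2 ^ n" by (intro power_mono) auto
    then have four: "(4::real) ^ n \<le> exp (2 * x)"
      by (simp add: x_def exp_of_nat_mult[symmetric] mult.commute)
    have "4 ^ n * (2 * exp (- 2 * t\<^sup>2 / real (n\<^sup>2))) \<le> exp (2 * x) * (2 * exp (- 4 * x))"
      using e by (intro mult_mono four) (auto simp: x_def)
    also have "\<dots> = 2 * exp (- 2 * x)"
      by (simp flip: exp_add)
    also have "\<dots> < \<epsilon>" using elim(2) by (simp add: x_def)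
    finally have "1 - \<epsilon> < 1 - 4 ^ n * (2 * exp (- 2 * t\<^sup>2 / real (n\<^sup>2)))" by simp
    also have "\<dots> \<le> measure_pmf.prob (random_dag n (p n))
        {G. fst G = {1..n} \<and> snd G \<subseteq> ordered_pairs n \<and> edge_regular n (p n) t (snd G)}"
      using pn t by (intro prob_edge_regular) auto
    also have "\<dots> \<le> measure_pmf.prob (random_dag n (p n)) {G. GAPEB G < ereal (1 + \<delta>)}"
      using GAPEB_less_of_edge_regular[OF _ _ pn(3) \<delta> elim(4)]
      by (intro measure_pmf.finite_measure_mono) (auto simp: t_def s_def x_def)
    finally show ?case .
  qed
  then show "\<exists>N. \<forall>n\<ge>N.
      measure_pmf.prob (random_dag n (p n)) {G. GAPEB G < ereal (1 + \<delta>)} > 1 - \<epsilon>"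
    by (simp add: eventually_sequentially)
qed

end
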